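(* Let $0<p<1$, $\lambda>0$, and $y\ge\tau_{p,\lambda}$. Define \[ \varepsilon(y):=\lambda p\,y^{p-2},\qquad S(y):=y\left(1-\varepsilon(y)-\sum_{n=2}^{\infty}\frac{\varepsilon(y)^n}{n!}\prod_{j=0}^{n-2}\bigl(n(1-p)+j\bigr)\right). \] The series defining $S(y)$ is absolutely convergent, uniformly for $y\in[\tau_{p,\lambda},\infty)$. Moreover, $S(y)=x_+(y)$, the larger positive solution $x$ of the stationary equation $x-y+\lambda p\,x^{p-1}=0$.
   Context: For $0<p<1$ and $\lambda>0$ set \[ \rho_{p,\lambda}:=\bigl(2\lambda(1-p)\bigr)^{\frac1{2-p}},\qquad \tau_{p,\lambda}:=\frac{2-p}{2(1-p)}\,\rho_{p,\lambda}. \] For $y\ge\tau_{p,\lambda}$ the equation $x-y+\lambda p\,x^{p-1}=0$ has exactly two distinct roots $x_-(y)<x_+(y)$ in $(0,\infty)$; $x_+(y)$ denotes the larger one. Uniform convergence refers to the series of functions of $y$ with the factor $y$ included in every term. *)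

theory Defs
  imports "HOL-Analysis.Analysis"
begin

definition rho :: "real \<Rightarrow> real \<Rightarrow> real" where
  "rho p lam = (2 * lam * (1 - p)) powr (1 / (2 - p))"

definition tau :: "real \<Rightarrow> real \<Rightarrow> real" where
  "tau p lam = (2 - p) / (2 * (1 - p)) * rho p lam"

definition stationary_roots :: "real \<Rightarrow> real \<Rightarrow> real \<Rightarrow> real set" where
  "stationary_roots p lam y = {x. 0 < x \<and> x - y + lam * p * x powr (p - 1) = 0}"

text \<open>\<open>Max\<close> is meaningful for \<open>y \<ge> tau p lam\<close>, where the set has exactly two elements;
  see \<open>stationary_roots_two\<close> below.\<close>

definition x_plus :: "real \<Rightarrow> real \<Rightarrow> real \<Rightarrow> real" where
  "x_plus p lam y = Max (stationary_roots p lam y)"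

definition eps :: "real \<Rightarrow> real \<Rightarrow> real \<Rightarrow> real" where
  "eps p lam y = lam * p * y powr (p - 2)"

text \<open>Only used for \<open>n \<ge> 2\<close>: for smaller \<open>n\<close> the truncated bound \<open>n - 2\<close> has no meaning.\<close>

definition ser_term :: "real \<Rightarrow> real \<Rightarrow> nat \<Rightarrow> real \<Rightarrow> real" where
  "ser_term p lam n y =
     eps p lam y ^ n / fact n * (\<Prod>j = 0..n - 2. real n * (1 - p) + real j)"

definition S :: "real \<Rightarrow> real \<Rightarrow> real \<Rightarrow> real" where
  "S p lam y = y * (1 - eps p lam y - (\<Sum>n. ser_term p lam (n + 2) y))"

lemma two_powr_mult_less_one:
  fixes p :: real
  assumes "0 < p" "p < 1"
  shows "2 powr (1 - p) * p < 1"
proof -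
  have "ln p \<le> p - 1" using assms by (intro ln_le_minus_one) auto
  moreover have "(1 - p) * ln 2 < 1 - p"
    using assms ln_2_less_1 mult_strict_left_mono[of "ln 2" 1 "1 - p"] by simp
  ultimately have "(1 - p) * ln 2 + ln p < 0" by linarith
  then have "ln (2 powr (1 - p) * p) < 0"
    using assms by (simp add: ln_mult ln_powr)
  then show ?thesis using assms by simp
qed

lemma stationary_roots_two:
  assumes p: "0 < p" "p < 1" and lam: "0 < lam" and y: "y \<ge> tau p lam"
  obtains xm xp where "0 < xm" "xm < xp" "stationary_roots p lam y = {xm, xp}"
proof -
  define c where "c = lam * p"
  define g where "g x = x + c * x powr (p - 1)" for x :: real
  define x0 where "x0 = (c * (1 - p)) powr (1 / (2 - p))"
  have c: "c > 0" using p lam by (simp add: c_def)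
  have x0: "x0 > 0" using p c by (simp add: x0_def)
  have x0p: "x0 powr (2 - p) = c * (1 - p)"
    using p c by (simp add: x0_def powr_powr)
  have x0_rho: "2 * x0 < rho p lam"
  proof -
    have "(2 * x0) powr (2 - p) = 2 powr (2 - p) * (c * (1 - p))"
      using x0 x0p by (simp add: powr_mult)
    also have "2 powr (2 - p) = 2 * 2 powr (1 - p)"
      using powr_add[of 2 1 "1 - p"] by simp
    also have "2 * 2 powr (1 - p) * (c * (1 - p)) = (2 * lam * (1 - p)) * (2 powr (1 - p) * p)"
      by (simp add: c_def)
    also have "\<dots> < (2 * lam * (1 - p)) * 1"
      using two_powr_mult_less_one[OF p] p lam by (intro mult_strict_left_mono) auto
    also have "\<dots> = rho p lam powr (2 - p)"
      using p lam by (simp add: rho_def powr_powr)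
    finally have *: "(2 * x0) powr (2 - p) < rho p lam powr (2 - p)" .
    show ?thesis
    proof (rule ccontr)
      assume "\<not> 2 * x0 < rho p lam"
      then have "rho p lam powr (2 - p) \<le> (2 * x0) powr (2 - p)"
        using p by (intro powr_mono2) (auto simp: rho_def)
      with * show False by simp
    qed
  qed
  have gx0: "g x0 < y"
  proof -
    have "x0 powr (2 - p) * x0 powr (p - 1) = x0"
      using x0 by (simp flip: powr_add)
    then have "(1 - p) * (c * x0 powr (p - 1)) = x0"
      using x0p by (simp add: mult_ac)
    then have "c * x0 powr (p - 1) = x0 / (1 - p)"
      using p by (simp add: eq_divide_eq mult.commute)
    then have "g x0 = x0 + x0 / (1 - p)" by (simp add: g_def)
    also have "\<dots> = (2 - p) / (2 * (1 - p)) * (2 * x0)"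
      using p by (simp add: field_simps)
    also have "\<dots> < tau p lam" unfolding tau_def
      using x0_rho p by (intro mult_strict_left_mono) auto
    finally show ?thesis using y by simp
  qed
  have deriv: "(g has_real_derivative (1 + c * ((p - 1) * x powr (p - 2)))) (at x)"
    if "x > 0" for x
    unfolding g_def using that
    by (auto intro!: derivative_eq_intros simp: diff_diff_eq)
  have cont: "continuous_on {a..b} g" if "a > 0" for a b
    unfolding g_def using that by (intro continuous_intros) auto
  have sgn: "1 + c * ((p - 1) * x powr (p - 2)) = 1 - (x0 / x) powr (2 - p)" if "x > 0" for x
  proof -
    have "(x0 / x) powr (2 - p) = x0 powr (2 - p) / x powr (2 - p)"
      using that x0 by (simp add: powr_divide)
    also have "\<dots> = c * (1 - p) * x powr (p - 2)"
      using x0p powr_minus[of x "2 - p"] by (simp add: divide_inverse)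
    finally have "(x0 / x) powr (2 - p) = c * (1 - p) * x powr (p - 2)" .
    then show ?thesis by (simp add: algebra_simps)
  qed
  have decr: "g b < g a" if "0 < a" "a < b" "b \<le> x0" for a b
  proof (rule DERIV_neg_imp_decreasing_open[OF that(2) _ cont[OF that(1)]])
    fix x assume x: "a < x" "x < b"
    then have "1 < (x0 / x) powr (2 - p)"
      using that p by (intro gr_one_powr) auto
    then show "\<exists>d. DERIV g x :> d \<and> d < 0"
      using deriv[of x] sgn[of x] x that by (intro exI[of _ "1 - (x0 / x) powr (2 - p)"]) auto
  qed
  have incr: "g a < g b" if "x0 \<le> a" "a < b" for a b
  proof (rule DERIV_pos_imp_increasing_open[OF that(2) _ cont])
    fix x assume x: "a < x" "x < b"
    then have "(x0 / x) powr (2 - p) < 1 powr (2 - p)"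
      using that p x0 by (intro powr_less_mono2) auto
    then show "\<exists>d. DERIV g x :> d \<and> d > 0"
      using deriv[of x] sgn[of x] x that x0 by (intro exI[of _ "1 - (x0 / x) powr (2 - p)"]) auto
  qed (use that x0 in auto)
  have x0y: "x0 < y"
  proof -
    have "0 < c * x0 powr (p - 1)" using c x0 by simp
    then show ?thesis using gx0 by (simp add: g_def)
  qed
  then have y0: "y > 0" using x0 by simp
  define a where "a = (y / c) powr (1 / (p - 1))"
  have a: "a > 0" using y0 c by (simp add: a_def)
  have "a powr (p - 1) = y / c" using p y0 c by (simp add: a_def powr_powr)
  then have ga: "g a = a + y" using c by (simp add: g_def)
  have ax0: "a < x0"
  proof (rule ccontr)
    assume "\<not> a < x0"
    then have "x0 powr (p - 1) \<ge> a powr (p - 1)"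
      using p x0 by (intro powr_mono2') auto
    then have "c * x0 powr (p - 1) \<ge> y"
      using c \<open>a powr (p - 1) = y / c\<close> by (simp add: field_simps)
    then show False using gx0 x0 by (simp add: g_def)
  qed
  obtain xm where xm: "a \<le> xm" "xm \<le> x0" "g xm = y"
    using IVT2'[of g x0 y a] gx0 ga a ax0 cont[OF a] by auto
  have gy: "g y > y" using c y0 by (simp add: g_def)
  obtain xp where xp: "x0 \<le> xp" "xp \<le> y" "g xp = y"
    using IVT'[of g x0 y y] gx0 gy x0y cont[OF x0] by auto
  have xm0: "0 < xm" using a xm by simp
  have "xm \<noteq> x0" "xp \<noteq> x0" using xm(3) xp(3) gx0 by blast+
  then have lt: "xm < x0" "x0 < xp" using xm(2) xp(1) by linarith+
  have root_iff: "x \<in> stationary_roots p lam y \<longleftrightarrow> 0 < x \<and> g x = y" for x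
    unfolding stationary_roots_def g_def c_def by auto
  have "x = xm \<or> x = xp" if "0 < x" "g x = y" for x
  proof (cases "x \<le> x0")
    case True
    have "\<not> x < xm" using decr[of x xm] xm that by force
    moreover have "\<not> xm < x" using decr[of xm x] xm xm0 that True by force
    ultimately show ?thesis by linarith
  next
    case False
    have "\<not> x < xp" using incr[of x xp] xp that False by force
    moreover have "\<not> xp < x" using incr[of xp x] xp that by force
    ultimately show ?thesis by linarith
  qed
  then have "stationary_roots p lam y = {xm, xp}"
    using root_iff xm(3) xp(3) xm0 x0 lt by (blast intro: less_trans)
  then show thesis using that[of xm xp] xm0 lt by simp
qed

end

theory Submission
  imports Defs "HOL-Complex_Analysis.Complex_Analysis"
begin

text \<open>
  Put \<open>q = 1 - p\<close> and \<open>x = y * (1 - v)\<close>. The stationary equation becomes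
  \<open>v * (1 - v) powr q = \<epsilon>\<close> with \<open>\<epsilon> = eps p lam y\<close>: it says that \<open>v\<close> is a preimage of \<open>\<epsilon>\<close>
  under \<open>g v = v * (1 - v) powr q\<close>. On the other side, \<open>S p lam y / y = 1 - F \<epsilon>\<close> where \<open>F\<close> is the Taylor
  series at \<open>0\<close> of the local inverse of \<open>g\<close>, as Lagrange inversion predicts. Three things carry the proof.

  The first is formal: \<open>F \<circ> g = X\<close> as power series (\<open>inverse_coeff_compose_stationary\<close>).
  The powers of \<open>g\<close> have binomial coefficients, so for \<open>k \<ge> 2\<close> the coefficient of \<open>X\<^sup>k\<close> in the
  composition is a \<open>k\<close>-th finite difference of a polynomial of degree at most \<open>k - 1\<close>, hence zero.

  The second is analytic. On \<open>[0, 1]\<close> the function \<open>g\<close> increases up to the critical point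
  \<open>r = 1 / (1 + q)\<close> and then decreases. The series \<open>F\<close> converges on the disc of radius \<open>g r\<close>,
  because its coefficients are single terms of binomial series with nonnegative terms
  (\<open>inverse_coeff_bound\<close>). As \<open>|g| < g r\<close> on a complex neighbourhood of \<open>[0, r)\<close>, the identity
  theorem carries \<open>F (g v) = v\<close> from a neighbourhood of \<open>0\<close> to all of \<open>[0, r)\<close>
  (\<open>inverse_coeff_sums\<close>).

  The third locates the root. For \<open>y \<ge> tau p lam\<close> there are two distinct stationary points, hence
  two distinct preimages of \<open>\<epsilon>\<close> under \<open>g\<close>. They cannot both lie in \<open>[r, 1)\<close>, where \<open>g\<close>
  is strictly monotone, so the smaller preimage, which is the one of the larger root, lies in
  \<open>[0, r)\<close>, where the series inverts \<open>g\<close>.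

  Uniformity is the Weierstrass test: every term of the series with the factor \<open>y\<close> is nonnegative
  and decreasing in \<open>y\<close>, so its value at \<open>tau p lam\<close> is a majorant.
\<close>

section \<open>Finite differences of products of linear factors\<close>

text \<open>
  The \<open>k\<close>-th finite difference kills polynomials of degree below \<open>k\<close>. Keeping the polynomial
  as a product of linear factors makes the induction close: a factor \<open>n\<close> is absorbed by
  \<open>n * (k choose n) = k * (k - 1 choose n - 1)\<close>, which lowers \<open>k\<close> by one and shifts the
  argument, that is, replaces \<open>b\<close> by \<open>a + b\<close>.
\<close>

lemma alternating_choose_prod_linear_eq_0:
  fixes a b :: "nat \<Rightarrow> 'a :: comm_ring_1"
  assumes "m < k"
  shows "(\<Sum>n\<le>k. (-1) ^ n * of_nat (k choose n) * (\<Prod>i<m. a i * of_nat n + b i)) = 0"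
  using assms
proof (induction m arbitrary: k b)
  case 0
  then show ?case using choose_alternating_sum[of k] by simp
next
  case (Suc m)
  then obtain l where k: "k = Suc l" by (cases k) auto
  define f where "f n = (\<Prod>i<m. a i * of_nat n + b i)" for n
  have shift: "(\<Sum>n\<le>l. (-1) ^ n * of_nat (l choose n) * f (Suc n)) = 0"
    using Suc.IH[of l "\<lambda>i. a i + b i"] Suc.prems k by (simp add: f_def algebra_simps)
  have absorb: "of_nat (Suc l choose Suc n) * of_nat (Suc n) = (of_nat (Suc l) * of_nat (l choose n) :: 'a)" for n
    unfolding of_nat_mult[symmetric] by (subst Suc_times_binomial[symmetric]) (simp only: mult.commute)
  have "(\<Sum>n\<le>k. (-1) ^ n * of_nat (k choose n) * (of_nat n * f n))
      = (\<Sum>n\<le>l. (-1) ^ Suc n * of_nat (Suc l choose Suc n) * (of_nat (Suc n) * f (Suc n)))"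
    unfolding k by (subst sum.atMost_Suc_shift) simp
  also have "\<dots> = (\<Sum>n\<le>l. - of_nat (Suc l) * ((-1) ^ n * of_nat (l choose n) * f (Suc n)))"
  proof (rule sum.cong)
    fix n
    have "(-1) ^ Suc n * of_nat (Suc l choose Suc n) * (of_nat (Suc n) * f (Suc n))
        = - ((-1) ^ n) * (of_nat (Suc l choose Suc n) * of_nat (Suc n)) * f (Suc n)"
      by (simp only: mult.assoc power_Suc mult_minus1)
    then show "(-1) ^ Suc n * of_nat (Suc l choose Suc n) * (of_nat (Suc n) * f (Suc n))
        = - of_nat (Suc l) * ((-1) ^ n * of_nat (l choose n) * f (Suc n))"
      unfolding absorb by (simp only: mult_ac mult_minus_left mult_minus_right)
  qed simp
  also have "\<dots> = 0"
    unfolding sum_distrib_left[symmetric] shift by simp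
  finally have lin: "(\<Sum>n\<le>k. (-1) ^ n * of_nat (k choose n) * (of_nat n * f n)) = 0" .
  have const: "(\<Sum>n\<le>k. (-1) ^ n * of_nat (k choose n) * f n) = 0"
    using Suc.IH[of k b] Suc.prems by (simp add: f_def)
  have "(\<Sum>n\<le>k. (-1) ^ n * of_nat (k choose n) * (\<Prod>i<Suc m. a i * of_nat n + b i))
      = (\<Sum>n\<le>k. a m * ((-1) ^ n * of_nat (k choose n) * (of_nat n * f n))
                + b m * ((-1) ^ n * of_nat (k choose n) * f n))"
    by (intro sum.cong) (simp_all add: f_def algebra_simps)
  also have "\<dots> = 0"
    unfolding sum.distrib sum_distrib_left[symmetric] lin const by simp
  finally show ?case .
qed

section \<open>The formal inverse of \<open>X (1 - X)\<^sup>q\<close>\<close>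

text \<open>
  For \<open>n \<ge> 1\<close> this is Lagrange's formula: the coefficient of \<open>X^(n - 1)\<close> in
  \<open>(1 - X) powr (- n q)\<close>, divided by \<open>n\<close>.
\<close>

definition inverse_coeff :: "'a :: field_char_0 \<Rightarrow> nat \<Rightarrow> 'a" where
  "inverse_coeff q n = (if n = 0 then 0 else pochhammer (of_nat n * q) (n - 1) / fact n)"

text \<open>The Taylor series of \<open>v * (1 - v) powr q\<close> at \<open>0\<close>.\<close>

definition stationary_fps :: "'a :: field_char_0 \<Rightarrow> 'a fps" where
  "stationary_fps q = fps_X * (fps_binomial q oo (- fps_X))"

lemma stationary_fps_power_nth:
  "fps_nth (stationary_fps q ^ n) k =
     (if k < n then 0 else (-1) ^ (k - n) * ((of_nat n * q) gchoose (k - n)))"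
proof -
  have "stationary_fps q ^ n = fps_X ^ n * (fps_binomial (of_nat n * q) oo (- fps_X))"
    by (simp add: stationary_fps_def power_mult_distrib fps_compose_power fps_binomial_power)
  then show ?thesis
    by (simp add: fps_X_power_mult_nth fps_compose_uminus')
qed

text \<open>
  With \<open>x = n q\<close> and \<open>m = k - n\<close>, the numerator of the coefficient of the inverse is the rising product
  \<open>x \<cdots> (x + n - 2)\<close>, and that of the binomial coefficient is the falling product \<open>x \<cdots> (x - m + 1)\<close>.
  They overlap in the factor \<open>x\<close> only, so together they form \<open>x\<close> times the run of \<open>k - 2\<close> consecutive
  factors that starts at \<open>x - m + 1\<close>. As \<open>x - m = (q + 1) n - k\<close>, this is a product of \<open>k - 1\<close> factors
  linear in \<open>n\<close>, and the denominators combine to \<open>(k choose n) / k!\<close>. The extra factor \<open>x = q n\<close>,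
  put in last position, makes the formula hold at \<open>n = 0\<close> too.
\<close>

lemma inverse_coeff_times_power_nth:
  fixes q :: "'a :: field_char_0"
  assumes "n \<le> k" "2 \<le> k"
  shows "inverse_coeff q n * fps_nth (stationary_fps q ^ n) k =
    (-1) ^ k / fact k * ((-1) ^ n * of_nat (k choose n) *
      (\<Prod>i<Suc (k - 2). (if i < k - 2 then q + 1 else q) * of_nat n
          + (if i < k - 2 then of_nat i + 1 - of_nat k else 0)))"
    (is "_ = _ * (_ * ?P)")
proof (cases "n = 0")
  case True
  then show ?thesis by (simp add: inverse_coeff_def)
next
  case False
  define m where "m = k - n"
  define x where "x = of_nat n * q"
  have k: "k = n + m" using assms by (simp add: m_def)
  have "?P = x * (\<Prod>i<k - 2. (x - of_nat m + 1) + of_nat i)"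
    unfolding prod.lessThan_Suc by (simp add: x_def k algebra_simps)
  also have "(\<Prod>i<k - 2. (x - of_nat m + 1) + of_nat i) = pochhammer (x - of_nat m + 1) (k - 2)"
    by (simp add: pochhammer_prod atLeast0LessThan)
  also have "x * \<dots> = pochhammer x (n - 1) * pochhammer (x - of_nat m + 1) m"
  proof (cases m)
    \<comment> \<open>Here the falling product is empty, and \<open>x\<close> is the first factor of the rising one.\<close>
    case 0
    then have "n - 1 = Suc (k - 2)" using k assms by simp
    then show ?thesis using 0 by (simp add: pochhammer_rec)
  next
    case (Suc l)
    then have "k - 2 = l + (n - 1)" using k False by simp
    then show ?thesis using Suc
      by (simp add: pochhammer_product' pochhammer_Suc algebra_simps)
  qed
  finally have P: "?P = pochhammer x (n - 1) * pochhammer (x - of_nat m + 1) m" .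
  have ch: "(of_nat (k choose n) :: 'a) = fact k / (fact n * fact m)"
    using binomial_fact[of n k, where 'a = 'a] assms by (simp add: m_def)
  have sgn: "(-1) ^ k * (-1) ^ n = ((-1) ^ m :: 'a)"
  proof -
    have "(-1) ^ n * (-1) ^ n = (1 :: 'a)" by (simp flip: power_mult_distrib)
    then show ?thesis unfolding k power_add by (metis mult.commute mult.left_commute mult_1_right)
  qed
  have "inverse_coeff q n * fps_nth (stationary_fps q ^ n) k
      = pochhammer x (n - 1) / fact n * ((-1) ^ m * (pochhammer (x - of_nat m + 1) m / fact m))"
    using False assms
    by (simp add: inverse_coeff_def stationary_fps_power_nth gbinomial_pochhammer' x_def m_def)
  also have "\<dots> = (-1) ^ k / fact k * ((-1) ^ n * of_nat (k choose n) * ?P)"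
    unfolding P ch sgn[symmetric] by (simp add: field_simps)
  finally show ?thesis .
qed

text \<open>
  All powers of \<open>g\<close> have closed coefficients, so this order of composition, unlike \<open>g \<circ> F\<close>, reduces
  to one finite difference per coefficient. It is also the order that suits the analysis: evaluating
  \<open>F \<circ> g\<close> takes the convergence of \<open>F\<close>, while \<open>g \<circ> F\<close> would call for bounds on its values.
\<close>

lemma inverse_coeff_compose_stationary:
  fixes q :: "'a :: field_char_0"
  shows "Abs_fps (inverse_coeff q) oo stationary_fps q = fps_X"
proof (rule fps_ext)
  fix k
  show "fps_nth (Abs_fps (inverse_coeff q) oo stationary_fps q) k = fps_nth fps_X k"
  proof (cases "k < 2")
    case True
    then have "k = 0 \<or> k = 1" by linarith
    then show ?thesis
      by (auto simp: fps_compose_nth inverse_coeff_def stationary_fps_def)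
  next
    case False
    have "fps_nth (Abs_fps (inverse_coeff q) oo stationary_fps q) k
        = (\<Sum>n\<le>k. (-1) ^ k / fact k * ((-1) ^ n * of_nat (k choose n) *
      (\<Prod>i<Suc (k - 2). (if i < k - 2 then q + 1 else q) * of_nat n
          + (if i < k - 2 then of_nat i + 1 - of_nat k else 0))))"
      unfolding fps_compose_nth atLeast0AtMost fps_nth_Abs_fps
      by (rule sum.cong[OF refl], rule inverse_coeff_times_power_nth) (use False in auto)
    also have "\<dots> = 0"
      unfolding sum_distrib_left[symmetric]
      by (subst alternating_choose_prod_linear_eq_0) (use False in auto)
    finally show ?thesis using False by simp
  qed
qed

section \<open>Convergence up to the critical value\<close>

lemma inverse_coeff_nonneg:
  fixes q :: real
  assumes "0 < q"
  shows "0 \<le> inverse_coeff q n"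
  using assms pochhammer_nonneg[of "real n * q" "n - 1"] by (auto simp: inverse_coeff_def)

text \<open>
  The left side is one of the nonnegative terms of the binomial series of the right side.
\<close>

lemma pochhammer_power_le_powr:
  fixes a r :: real
  assumes "0 < a" "0 \<le> r" "r < 1"
  shows "pochhammer a k / fact k * r ^ k \<le> (1 - r) powr (- a)"
proof -
  have eq: "(- a gchoose n) * (- r) ^ n = pochhammer a n / fact n * r ^ n" for n
  proof -
    have "(- 1) ^ n * (- r) ^ n = r ^ n" by (simp flip: power_mult_distrib)
    then show ?thesis by (simp add: gbinomial_pochhammer mult.assoc mult.left_commute)
  qed
  have "(\<lambda>n. pochhammer a n / fact n * r ^ n) sums (1 - r) powr (- a)"
    using gen_binomial_real[of "- r" "- a"] assms by (simp add: eq)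
  moreover have "0 \<le> pochhammer a n / fact n * r ^ n" for n
    using assms by (intro mult_nonneg_nonneg divide_nonneg_nonneg pochhammer_nonneg) auto
  ultimately show ?thesis
    using sum_le_suminf[of "\<lambda>n. pochhammer a n / fact n * r ^ n" "{k}"] by (simp add: sums_iff)
qed

text \<open>
  This is Cauchy's estimate on the circle of radius \<open>r\<close> in Lagrange's formula. It holds for every \<open>r\<close>,
  and is sharpest at the maximum of \<open>r * (1 - r) powr q\<close>, which is \<open>r = 1 / (1 + q)\<close>.
\<close>

lemma inverse_coeff_bound:
  fixes q r :: real
  assumes "0 < q" "0 < r" "r < 1"
  shows "inverse_coeff q n * (r * (1 - r) powr q) ^ n \<le> r"
proof (cases n)
  case 0
  then show ?thesis using assms by (simp add: inverse_coeff_def)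
next
  case (Suc m)
  define a where "a = real n * q"
  have a: "a > 0" using assms Suc by (simp add: a_def)
  have "inverse_coeff q n * (r * (1 - r) powr q) ^ n
      = r / real n * ((pochhammer a m / fact m * r ^ m) * (1 - r) powr a)"
  proof -
    have "((1 - r) powr q) ^ n = (1 - r) powr a"
      using assms by (simp add: powr_power a_def mult.commute)
    then show ?thesis
      using Suc by (simp add: inverse_coeff_def a_def power_mult_distrib del: of_nat_Suc)
  qed
  also have "\<dots> \<le> r / real n * ((1 - r) powr (- a) * (1 - r) powr a)"
    using pochhammer_power_le_powr[OF a, of r m] assms
    by (intro mult_left_mono mult_right_mono) auto
  also have "\<dots> = r / real n"
    using assms by (simp flip: powr_add)
  also have "\<dots> \<le> r"
    using assms Suc by (simp add: field_simps)
  finally show ?thesis .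
qed

lemma inverse_coeff_of_real:
  "inverse_coeff (of_real q :: complex) n = of_real (inverse_coeff q n)"
proof -
  have "of_nat n * complex_of_real q = of_real (real n * q)" by simp
  then show ?thesis unfolding inverse_coeff_def by (simp only: pochhammer_of_real) simp
qed

lemma conv_radius_inverse_coeff:
  fixes q r :: real
  assumes "0 < q" "0 < r" "r < 1"
  shows "ereal (r * (1 - r) powr q) \<le> fps_conv_radius (Abs_fps (inverse_coeff (of_real q :: complex)))"
  unfolding fps_conv_radius_def fps_nth_Abs_fps
proof (rule conv_radius_geI_ex')
  define R where "R = r * (1 - r) powr q"
  have R: "R > 0" using assms by (simp add: R_def)
  fix s assume s: "0 < s" "ereal s < ereal (r * (1 - r) powr q)"
  then have sR: "s < R" by (simp add: R_def)
  have "summable (\<lambda>n. inverse_coeff q n * s ^ n)"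
  proof (rule summable_comparison_test'[of "\<lambda>n. r * (s / R) ^ n" 0])
    show "summable (\<lambda>n. r * (s / R) ^ n)"
      using s sR R by (intro summable_mult summable_geometric) auto
    fix n
    have "inverse_coeff q n * s ^ n = (inverse_coeff q n * R ^ n) * (s / R) ^ n"
      using R by (simp add: power_divide)
    also have "\<dots> \<le> r * (s / R) ^ n"
      using inverse_coeff_bound[OF assms, of n] s R by (intro mult_right_mono) (auto simp: R_def)
    finally show "norm (inverse_coeff q n * s ^ n) \<le> r * (s / R) ^ n"
      using inverse_coeff_nonneg[OF assms(1), of n] s by simp
  qed
  then have "summable (\<lambda>n. complex_of_real (inverse_coeff q n * s ^ n))"
    by (rule summable_of_real)
  then show "summable (\<lambda>n. inverse_coeff (complex_of_real q) n * complex_of_real s ^ n)"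
    by (simp add: inverse_coeff_of_real)
qed

section \<open>Inverting \<open>v (1 - v)\<^sup>q\<close> below its critical point\<close>

lemma
  fixes q :: real
  assumes q: "0 < q"
  shows stationary_fun_less_left:
      "\<lbrakk>0 \<le> a; a < b; b \<le> 1 / (1 + q)\<rbrakk> \<Longrightarrow> a * (1 - a) powr q < b * (1 - b) powr q"
    and stationary_fun_less_right:
      "\<lbrakk>1 / (1 + q) \<le> a; a < b; b < 1\<rbrakk> \<Longrightarrow> b * (1 - b) powr q < a * (1 - a) powr q"
proof -
  define g where "g v = v * (1 - v) powr q" for v :: real
  have r: "1 / (1 + q) < 1" "0 < 1 / (1 + q)" using q by auto
  have deriv: "(g has_real_derivative (1 - v) powr (q - 1) * (1 - (1 + q) * v)) (at v)" if "v < 1" for v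
  proof -
    have "(1 - v) powr q = (1 - v) powr (q - 1) * (1 - v)"
      using that powr_add[of "1 - v" "q - 1" 1] by simp
    then show ?thesis
      unfolding g_def using that
      by (auto intro!: derivative_eq_intros simp: algebra_simps)
  qed
  have cont: "continuous_on {a..b} g" if "b < 1" for a b
    unfolding g_def using that by (intro continuous_intros) auto
  show "a * (1 - a) powr q < b * (1 - b) powr q" if "0 \<le> a" "a < b" "b \<le> 1 / (1 + q)"
  proof -
    have "g a < g b"
    proof (rule DERIV_pos_imp_increasing_open[OF that(2) _ cont])
      fix v assume v: "a < v" "v < b"
      then have "v < 1" "v < 1 / (1 + q)" using that r by linarith+
      then have "0 < 1 - (1 + q) * v" using q by (simp add: field_simps)
      then have "0 < (1 - v) powr (q - 1) * (1 - (1 + q) * v)" using \<open>v < 1\<close> by simp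
      with deriv[OF \<open>v < 1\<close>] show "\<exists>d. DERIV g v :> d \<and> d > 0" by blast
    qed (use that r in linarith)
    then show ?thesis by (simp add: g_def)
  qed
  show "b * (1 - b) powr q < a * (1 - a) powr q" if "1 / (1 + q) \<le> a" "a < b" "b < 1"
  proof -
    have "g b < g a"
    proof (rule DERIV_neg_imp_decreasing_open[OF that(2) _ cont])
      fix v assume v: "a < v" "v < b"
      then have "v < 1" "1 / (1 + q) < v" using that by linarith+
      then have "1 - (1 + q) * v < 0" using q by (simp add: field_simps)
      then have "(1 - v) powr (q - 1) * (1 - (1 + q) * v) < 0"
        using \<open>v < 1\<close> by (simp add: mult_pos_neg)
      with deriv[OF \<open>v < 1\<close>] show "\<exists>d. DERIV g v :> d \<and> d < 0" by blast
    qed (use that in linarith)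
    then show ?thesis by (simp add: g_def)
  qed
qed

text \<open>
  Near \<open>0\<close> the formal identity gives \<open>F (g w) = w\<close>. The composition \<open>F \<circ> g\<close> is holomorphic wherever
  \<open>|g w|\<close> stays below the critical value, and \<open>[0, r)\<close> lies in one component \<open>A\<close> of this open
  set, so that the identity theorem on \<open>A\<close> reaches every \<open>v < r\<close>.
\<close>

lemma inverse_coeff_sums:
  fixes q v :: real
  assumes q: "0 < q" and v: "0 \<le> v" "v < 1 / (1 + q)"
  shows "(\<lambda>n. inverse_coeff q n * (v * (1 - v) powr q) ^ n) sums v"
proof -
  define F where "F = Abs_fps (inverse_coeff (complex_of_real q))"
  define g where "g w = w * (1 - w) powr complex_of_real q" for w :: complex
  define r where "r = 1 / (1 + q)"
  define R where "R = r * (1 - r) powr q"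
  define U where "U = {w \<in> ball 0 1. norm (g w) < R}"
  define A where "A = connected_component_set U 0"
  have r: "0 < r" "r < 1" using q by (auto simp: r_def)
  have R: "0 < R" using r by (simp add: R_def)
  have rad: "ereal R \<le> fps_conv_radius F"
    unfolding F_def R_def by (rule conv_radius_inverse_coeff[OF q r])
  have rad_pos: "0 < fps_conv_radius F"
    using R rad by (meson ereal_less(2) less_le_trans)
  have nonpos: "1 - w \<notin> \<real>\<^sub>\<le>\<^sub>0" if "w \<in> ball 0 1" for w :: complex
  proof -
    have "Re w < 1" using that complex_Re_le_cmod[of w] by simp
    then show ?thesis by (auto simp: complex_nonpos_Reals_iff)
  qed
  have hol_g: "g holomorphic_on ball 0 1"
    unfolding g_def using nonpos by (intro holomorphic_intros) auto
  have "open U"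
  proof -
    have "open (ball 0 1 \<inter> (\<lambda>w. norm (g w)) -` {..<R})"
      using hol_g
      by (intro continuous_open_preimage continuous_on_norm holomorphic_on_imp_continuous_on) auto
    also have "ball 0 1 \<inter> (\<lambda>w. norm (g w)) -` {..<R} = U" by (auto simp: U_def)
    finally show ?thesis .
  qed
  have in_disc: "ereal (norm (g w)) < fps_conv_radius F" if "w \<in> U" for w
  proof -
    have "ereal (norm (g w)) < ereal R" using that by (simp add: U_def)
    then show ?thesis using rad by (rule less_le_trans)
  qed
  have real_in_U: "complex_of_real u \<in> U" and g_real: "g (complex_of_real u) = of_real (u * (1 - u) powr q)"
    if "0 \<le> u" "u < r" for u
  proof -
    show *: "g (complex_of_real u) = of_real (u * (1 - u) powr q)"
      unfolding g_def using that r powr_of_real[of "1 - u" q] by simp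
    have "u * (1 - u) powr q < R"
      unfolding R_def using stationary_fun_less_left[OF q that(1), of r] that by (simp add: r_def)
    then show "complex_of_real u \<in> U"
      using that r by (simp add: U_def * norm_of_real del: of_real_mult)
  qed
  have A: "open A" "connected A" "A \<subseteq> U" "0 \<in> A"
    unfolding A_def using \<open>open U\<close> real_in_U[of 0] r
    by (auto simp: open_connected_component connected_component_subset connected_component_refl)
  have vA: "complex_of_real v \<in> A"
  proof -
    have "connected (complex_of_real ` {0..<r})"
      by (intro connected_continuous_image continuous_intros) auto
    moreover have "complex_of_real ` {0..<r} \<subseteq> U" using real_in_U by auto
    ultimately have "complex_of_real ` {0..<r} \<subseteq> A"
      unfolding A_def using r by (intro connected_component_maximal) (auto intro!: image_eqI[of _ _ 0])
    then show ?thesis using v by (auto simp: r_def)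
  qed
  have exp_g: "g has_fps_expansion stationary_fps (complex_of_real q)"
  proof -
    have "((\<lambda>x. (1 + x) powr complex_of_real q) \<circ> (\<lambda>w. - w)) has_fps_expansion
        (fps_binomial (of_real q) oo (- fps_X))"
      by (intro has_fps_expansion_compose has_fps_expansion_binomial_complex
                has_fps_expansion_minus has_fps_expansion_fps_X) simp
    then have "(\<lambda>w. w * ((\<lambda>x. (1 + x) powr complex_of_real q) \<circ> (\<lambda>w. - w)) w) has_fps_expansion
        stationary_fps (of_real q)"
      unfolding stationary_fps_def by (intro has_fps_expansion_mult has_fps_expansion_fps_X)
    then show ?thesis by (simp add: o_def g_def[abs_def])
  qed
  have "(eval_fps F \<circ> g) has_fps_expansion (F oo stationary_fps (of_real q))"
    by (intro has_fps_expansion_compose eval_fps_has_fps_expansion rad_pos exp_g)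
       (simp add: stationary_fps_def)
  then have "(\<lambda>w. (eval_fps F \<circ> g) w - w) has_fps_expansion fps_X - fps_X"
    unfolding F_def inverse_coeff_compose_stationary
    by (intro has_fps_expansion_diff has_fps_expansion_fps_X)
  then have exp_0: "(\<lambda>w. (eval_fps F \<circ> g) w - w) has_fps_expansion 0" by simp
  have "(\<lambda>w. (eval_fps F \<circ> g) w - w) holomorphic_on A"
  proof (intro holomorphic_intros holomorphic_on_compose_gen[where t = "eball 0 (fps_conv_radius F)"])
    show "g holomorphic_on A"
      by (rule holomorphic_on_subset[OF hol_g]) (use A(3) in \<open>auto simp: U_def\<close>)
    show "g ` A \<subseteq> eball 0 (fps_conv_radius F)"
      using in_disc A(3) by auto
  qed auto
  from has_fps_expansion_0_analytic_continuation[OF exp_0 this A(1,2,4) vA]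
  have "eval_fps F (of_real (v * (1 - v) powr q)) = of_real v"
    using g_real[of v] v by (simp add: r_def)
  moreover have "ereal (norm (complex_of_real (v * (1 - v) powr q))) < fps_conv_radius F"
    using in_disc[OF real_in_U[of v]] g_real[of v] v by (simp add: r_def)
  ultimately have "(\<lambda>n. fps_nth F n * of_real (v * (1 - v) powr q) ^ n) sums of_real v"
    using sums_eval_fps by metis
  then have "(\<lambda>n. complex_of_real (inverse_coeff q n * (v * (1 - v) powr q) ^ n)) sums of_real v"
    by (simp add: F_def inverse_coeff_of_real)
  then show ?thesis by (simp only: sums_of_real_iff)
qed

section \<open>The larger stationary point\<close>

text \<open>
  Both stationary points give preimages of \<open>eps p lam y\<close> under \<open>v * (1 - v) powr (1 - p)\<close>, namely
  \<open>v = 1 - x / y\<close>. That there are two of them is what puts the smaller one strictly below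
  the critical point: beyond it the function is injective.
\<close>

lemma x_plus_parametrization:
  assumes p: "0 < p" "p < 1" and lam: "0 < lam" and y: "y \<ge> tau p lam"
  obtains v where "0 \<le> v" "v < 1 / (1 + (1 - p))"
    "eps p lam y = v * (1 - v) powr (1 - p)" "x_plus p lam y = y * (1 - v)"
proof -
  obtain xm xp where x: "0 < xm" "xm < xp" and roots: "stationary_roots p lam y = {xm, xp}"
    using stationary_roots_two[OF assms] .
  have root: "0 < 1 - x / y \<and> eps p lam y = (1 - x / y) * (1 - (1 - x / y)) powr (1 - p) \<and> x < y"
    if "x \<in> {xm, xp}" for x
  proof -
    have "x \<in> stationary_roots p lam y" using that roots by simp
    then have x0: "0 < x" and eq: "lam * p * x powr (p - 1) = y - x"
      by (simp_all add: stationary_roots_def)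
    have "0 < lam * p * x powr (p - 1)" using p lam x0 by simp
    with eq have "x < y" by simp
    have y0: "0 < y" using x0 \<open>x < y\<close> by simp
    have "lam * p = lam * p * (x powr (p - 1) * x powr (1 - p))"
      using x0 powr_add[of x "p - 1" "1 - p"] by simp
    also have "\<dots> = (y - x) * x powr (1 - p)"
      by (simp only: eq mult.assoc[symmetric])
    finally have "eps p lam y = (y - x) * x powr (1 - p) * y powr (p - 2)"
      by (simp add: eps_def)
    also have "y powr (p - 2) = y powr (- 1) * y powr (- (1 - p))"
      using powr_add[of y "- 1" "- (1 - p)"] by simp
    also have "(y - x) * x powr (1 - p) * \<dots> = (1 - x / y) * (x / y) powr (1 - p)"
    proof -
      have "y powr (- 1) * y powr (- (1 - p)) = 1 / y * (1 / y powr (1 - p))"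
        unfolding powr_minus[of y 1] powr_minus[of y "1 - p"] using y0 by (simp add: divide_inverse)
      moreover have "1 - x / y = (y - x) / y" using y0 by (simp add: field_simps)
      moreover have "(x / y) powr (1 - p) = x powr (1 - p) / y powr (1 - p)"
        using x0 y0 by (simp add: powr_divide)
      ultimately show ?thesis by simp
    qed
    finally show ?thesis using \<open>x < y\<close> y0 by simp
  qed
  define v where "v = 1 - xp / y"
  define w where "w = 1 - xm / y"
  have y0: "0 < y" using root[of xp] x by simp
  have vw: "v < w" "w < 1" using x y0 by (auto simp: v_def w_def divide_strict_right_mono)
  have eps: "eps p lam y = v * (1 - v) powr (1 - p)" "eps p lam y = w * (1 - w) powr (1 - p)"
    using root by (simp_all add: v_def w_def)
  have "v < 1 / (1 + (1 - p))"
    using stationary_fun_less_right[of "1 - p" v w] vw eps p by force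
  moreover have "x_plus p lam y = y * (1 - v)"
    using x y0 by (simp add: x_plus_def roots v_def max_def)
  ultimately show ?thesis
    using that[of v] root[of xp] eps(1) by (simp add: v_def)
qed

section \<open>The series\<close>

lemma ser_term_eq_inverse_coeff:
  "ser_term p lam (n + 2) y = inverse_coeff (1 - p) (n + 2) * eps p lam y ^ (n + 2)"
  by (simp add: ser_term_def inverse_coeff_def pochhammer_Suc_prod add.commute del: power_Suc)

text \<open>
  The factor \<open>t\<close> grows, but one factor \<open>eps\<close> outweighs it: \<open>t * eps p lam t\<close> is a multiple of
  \<open>t powr (p - 1)\<close>, and the remaining powers of \<open>eps\<close> decrease.
\<close>

lemma times_ser_term_antimono:
  assumes p: "0 < p" "p < 1" and lam: "0 < lam" and ts: "0 < s" "s \<le> t"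
  shows "t * ser_term p lam (n + 2) t \<le> s * ser_term p lam (n + 2) s"
proof -
  have mult_eps: "u * eps p lam u = lam * p * u powr (p - 1)" if "0 < u" for u
    using that powr_add[of u 1 "p - 2"] by (simp add: eps_def)
  have eps_nonneg: "0 \<le> eps p lam u" for u
    using p lam by (simp add: eps_def)
  have "t * eps p lam t \<le> s * eps p lam s"
    using p lam ts by (simp add: mult_eps powr_mono2')
  moreover have "eps p lam t \<le> eps p lam s"
    using p lam ts by (simp add: eps_def powr_mono2')
  then have "eps p lam t ^ (n + 1) \<le> eps p lam s ^ (n + 1)"
    by (rule power_mono[OF _ eps_nonneg])
  ultimately have "(t * eps p lam t) * eps p lam t ^ (n + 1) \<le> (s * eps p lam s) * eps p lam s ^ (n + 1)"
    by (rule mult_mono) (use ts eps_nonneg in auto)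
  then have "inverse_coeff (1 - p) (n + 2) * ((t * eps p lam t) * eps p lam t ^ (n + 1))
      \<le> inverse_coeff (1 - p) (n + 2) * ((s * eps p lam s) * eps p lam s ^ (n + 1))"
    using p inverse_coeff_nonneg[of "1 - p" "n + 2"] by (intro mult_left_mono) auto
  then show ?thesis
    unfolding ser_term_eq_inverse_coeff by (simp add: mult_ac)
qed

lemma ser_term_nonneg:
  assumes "0 < p" "p < 1" "0 < lam"
  shows "0 \<le> ser_term p lam (n + 2) y"
  unfolding ser_term_eq_inverse_coeff using assms inverse_coeff_nonneg[of "1 - p" "n + 2"]
  by (intro mult_nonneg_nonneg) (auto simp: eps_def)

lemma tau_pos:
  assumes "0 < p" "p < 1" "0 < lam"
  shows "0 < tau p lam"
  using assms by (auto simp: tau_def rho_def intro!: mult_pos_pos divide_pos_pos)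

lemma ser_term_sums:
  assumes p: "0 < p" "p < 1" and lam: "0 < lam" and y: "y \<ge> tau p lam"
  shows "summable (\<lambda>n. ser_term p lam (n + 2) y)" "S p lam y = x_plus p lam y"
proof -
  obtain v where v: "0 \<le> v" "v < 1 / (1 + (1 - p))"
    "eps p lam y = v * (1 - v) powr (1 - p)" "x_plus p lam y = y * (1 - v)"
    using x_plus_parametrization[OF assms] .
  have "(\<lambda>n. inverse_coeff (1 - p) n * eps p lam y ^ n) sums v"
    unfolding v(3) using v p by (intro inverse_coeff_sums) auto
  then have "(\<lambda>n. inverse_coeff (1 - p) (n + 2) * eps p lam y ^ (n + 2)) sums
      (v - (\<Sum>n<2. inverse_coeff (1 - p) n * eps p lam y ^ n))"
    by (subst sums_iff_shift) simp
  also have "(\<Sum>n<2. inverse_coeff (1 - p) n * eps p lam y ^ n) = eps p lam y"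
    by (simp add: inverse_coeff_def numeral_2_eq_2)
  finally have "(\<lambda>n. ser_term p lam (n + 2) y) sums (v - eps p lam y)"
    by (simp only: ser_term_eq_inverse_coeff)
  then show "summable (\<lambda>n. ser_term p lam (n + 2) y)" "S p lam y = x_plus p lam y"
    by (simp_all add: sums_iff S_def v(4))
qed

theorem theorem3p3:
  fixes p lam y :: real
  assumes "0 < p" and "p < 1" and "0 < lam" and "y \<ge> tau p lam"
  shows "summable (\<lambda>n. \<bar>y * ser_term p lam (n + 2) y\<bar>)
    \<and> uniformly_convergent_on {tau p lam..} (\<lambda>N t. \<Sum>n = 2..N. \<bar>t * ser_term p lam n t\<bar>)
    \<and> uniform_limit {tau p lam..}
        (\<lambda>N t. t - t * eps p lam t - (\<Sum>n = 2..N. t * ser_term p lam n t)) (S p lam) sequentially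
    \<and> S p lam y = x_plus p lam y"
proof -
  note plam = assms(1-3)
  let ?T = "tau p lam"
  let ?f = "\<lambda>n t. t * ser_term p lam (n + 2) t"
  have T: "0 < ?T" by (rule tau_pos[OF plam])
  have nonneg: "0 \<le> ?f n t" if "?T \<le> t" for n t
    using that T ser_term_nonneg[OF plam, of n t] by simp
  have bound: "norm (?f n t) \<le> ?f n ?T" if "t \<in> {?T..}" for n t
    using that nonneg[of t n] times_ser_term_antimono[OF plam T, of t n] by simp
  have "summable (\<lambda>n. ?f n ?T)"
    by (intro summable_mult ser_term_sums(1)[OF plam]) simp
  from Weierstrass_m_test[OF bound this]
  have "uniform_limit {?T..} (\<lambda>N t. \<Sum>n<N. ?f n t) (\<lambda>t. \<Sum>n. ?f n t) sequentially" .
  \<comment> \<open>The sum over \<open>{2..N}\<close> has \<open>N - 1\<close> terms, and none for \<open>N = 0\<close>, in line with truncated subtraction.\<close>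
  from filterlim_compose[OF this filterlim_minus_const_nat_at_top[of 1]]
  have lim: "uniform_limit {?T..} (\<lambda>N t. \<Sum>n<N - 1. ?f n t) (\<lambda>t. \<Sum>n. ?f n t) sequentially" .
  have reindex: "(\<Sum>n<N - 1. h (n + 2)) = (\<Sum>n = 2..N. h n)" for N and h :: "nat \<Rightarrow> real"
    by (rule sum.reindex_bij_witness[of _ "\<lambda>n. n - 2" "\<lambda>n. n + 2"]) auto
  have lim2: "uniform_limit {?T..} (\<lambda>N t. \<Sum>n = 2..N. t * ser_term p lam n t) (\<lambda>t. \<Sum>n. ?f n t) sequentially"
    using lim by (simp only: reindex[of "\<lambda>n. _ * ser_term p lam n _"])
  have "uniform_limit {?T..} (\<lambda>N t. \<Sum>n = 2..N. \<bar>t * ser_term p lam n t\<bar>) (\<lambda>t. \<Sum>n. ?f n t) sequentially"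
  proof (rule uniform_limit_cong'[THEN iffD1, OF _ _ lim2])
    fix N t assume "t \<in> {?T..}"
    then show "(\<Sum>n = 2..N. t * ser_term p lam n t) = (\<Sum>n = 2..N. \<bar>t * ser_term p lam n t\<bar>)"
      unfolding reindex[symmetric] using nonneg[of t] by (intro sum.cong) auto
  qed simp
  moreover have "uniform_limit {?T..}
        (\<lambda>N t. t - t * eps p lam t - (\<Sum>n = 2..N. t * ser_term p lam n t)) (S p lam) sequentially"
  proof (rule uniform_limit_cong'[THEN iffD1])
    show "uniform_limit {?T..} (\<lambda>N t. (t - t * eps p lam t) - (\<Sum>n = 2..N. t * ser_term p lam n t))
        (\<lambda>t. (t - t * eps p lam t) - (\<Sum>n. ?f n t)) sequentially"
      by (intro uniform_limit_intros lim2)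
    fix t assume "t \<in> {?T..}"
    then show "(t - t * eps p lam t) - (\<Sum>n. ?f n t) = S p lam t"
      using ser_term_sums(1)[OF plam, of t] by (simp add: S_def suminf_mult algebra_simps)
  qed simp
  moreover have "summable (\<lambda>n. \<bar>?f n y\<bar>)"
    using nonneg[OF assms(4)] summable_mult[OF ser_term_sums(1)[OF assms], of y] by simp
  moreover have "S p lam y = x_plus p lam y"
    by (rule ser_term_sums(2)[OF assms])
  ultimately show ?thesis
    unfolding uniformly_convergent_on_def by blast
qed

end
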